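(* Let $f:\mathbb{N}\to\mathbb{C}$ with $f(k)\neq 0$ for all $k\geq 1$, and let $t\in\mathbb{C}$, $t\neq 0$. For any integers $n\geq 0$ and $p\geq 2$, both of the following identities hold: \begin{align*} F_{n+1}^{(p)}(t^p) ={}& F_n^{(p)}(t^p) + \sum_{1\leq j<p}\genfrac{[}{]}{0pt}{}{n+2}{p+1-j}_{f(t)}\frac{(-1)^{p+1-j}\,t^{j(n+1)}}{f(n+1)^{j}\,(n+1)!_{f(t)}} + \genfrac{[}{]}{0pt}{}{n+1}{p}_{f(t)}\frac{(-1)^{p+1}}{(n+1)!_{f(t)}}, \end{align*} and \begin{align*} F_{n+1}^{(p)}(t^p) ={}& F_n^{(p)}(t^p) + \frac{t^{(p-1)(n+1)}}{f(n+1)^{p-1}} + \frac{(-1)^{p-1}}{(n+1)!_{f(t)}}\left(\genfrac{[}{]}{0pt}{}{n+1}{p}_{f(t)}+\genfrac{[}{]}{0pt}{}{n+1}{p-1}_{f(t)}\right)\\ &+\genfrac{[}{]}{0pt}{}{n+2}{p}_{f(t)}\frac{(-1)^{p}\,t^{n+1}}{f(n+1)\,(n+1)!_{f(t)}}\\ &+\sum_{j=0}^{p-3}\genfrac{[}{]}{0pt}{}{n+2}{j+2}_{f(t)}\frac{(-1)^{j+1}\left(f(n+1)\,t^{-(n+1)}-1\right)t^{(p-1-j)(n+1)}}{f(n+1)^{p-1-j}\,(n+1)!_{f(t)}}, \end{align*} where the last sum is empty when $p=2$.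
   Context: Generalized Stirling numbers of the first kind: for $f:\mathbb{N}\to\mathbb{C}$, nonzero $t\in\mathbb{C}$ and integers $n,k\geq 1$, $$\genfrac{[}{]}{0pt}{}{n}{k}_{f(t)} := [x^{k-1}]\prod_{j=1}^{n-1}\left(x+\frac{f(j)}{t^j}\right),$$ the coefficient of $x^{k-1}$ in the product (the empty product is $1$); also $\genfrac{[}{]}{0pt}{}{0}{0}_{f(t)}=1$, and $\genfrac{[}{]}{0pt}{}{n}{0}_{f(t)}=0=\genfrac{[}{]}{0pt}{}{0}{n}_{f(t)}$ for $n\geq 1$. Equivalently, for $n,k\ge 1$ they satisfy $\genfrac{[}{]}{0pt}{}{n}{k}_{f(t)} = f(n-1)\,t^{1-n}\genfrac{[}{]}{0pt}{}{n-1}{k}_{f(t)}+\genfrac{[}{]}{0pt}{}{n-1}{k-1}_{f(t)}$. $f(t)$-factorials: $n!_{f(t)} := \prod_{j=1}^{n}\frac{f(j)}{t^j}$ (with $0!_{f(t)}=1$). The $p$-order $f$-harmonic numbers are $F_n^{(p)}(t) := \sum_{k=1}^{n}\frac{t^k}{f(k)^p}$ (with $F_0^{(p)}(t)=0$); thus $F_n^{(p)}(t^p)=\sum_{k=1}^n \frac{t^{pk}}{f(k)^p}$. *)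

theory Defs
  imports Complex_Main "HOL-Computational_Algebra.Polynomial"
begin

definition gen_stirling1 :: "(nat \<Rightarrow> complex) \<Rightarrow> complex \<Rightarrow> nat \<Rightarrow> nat \<Rightarrow> complex" where
  "gen_stirling1 f t n k =
     (if n = 0 \<and> k = 0 then 1
      else if n = 0 \<or> k = 0 then 0
      else coeff (\<Prod>j=1..n-1. [:f j / t ^ j, 1:]) (k - 1))"

definition gen_fact :: "(nat \<Rightarrow> complex) \<Rightarrow> complex \<Rightarrow> nat \<Rightarrow> complex" where
  "gen_fact f t n = (\<Prod>j=1..n. f j / t ^ j)"

text \<open>\<open>gen_harm f p n t\<close> is \<open>F_n^(p)(t)\<close>. The argument \<open>t\<close> is independent of the parameter
  of the other two functions: \<open>F_n^(p)(t^p)\<close> is \<open>gen_harm f p n (t ^ p)\<close>.\<close>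

definition gen_harm :: "(nat \<Rightarrow> complex) \<Rightarrow> nat \<Rightarrow> nat \<Rightarrow> complex \<Rightarrow> complex" where
  "gen_harm f p n t = (\<Sum>k=1..n. t ^ k / f k ^ p)"

end

theory Submission
  imports Defs
begin

text \<open>
  Put \<open>a = f (n+1) / t ^ (n+1)\<close>. The two harmonic numbers differ by the single term \<open>1 / a ^ p\<close>,
  so both identities are expansions of this one power in generalized Stirling numbers.
  By the triangular recurrence \<open>[n+2, m+2] = a * [n+1, m+2] + [n+1, m+1]\<close>, the alternating sum of
  the numbers \<open>[n+2, m+2]\<close> weighted by \<open>(-1) ^ m * a ^ (m+1)\<close> telescopes. Its lower boundary term is
  \<open>a * [n+1, 1]\<close>, which is the factorial of \<open>n+1\<close>, and its upper boundary term is a multiple of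
  \<open>[n+1, q+1]\<close>, where \<open>q\<close> is the number of summands. This is the lemma
  \<open>sum_alternating_gen_stirling1\<close>.

  Dividing the sum with \<open>p - 1\<close> summands by \<open>a ^ p\<close> times the factorial gives the first identity.
  In the second identity the factor \<open>a - 1\<close> does not depend on the summation index, and what
  remains is the same sum with \<open>p - 2\<close> summands. The two Stirling numbers in its boundary terms
  then cancel against the explicit ones by one more use of the recurrence.
\<close>

lemma gen_stirling1_Suc_Suc:
  "gen_stirling1 f t (n + 2) (k + 2) =
     f (n + 1) / t ^ (n + 1) * gen_stirling1 f t (n + 1) (k + 2) + gen_stirling1 f t (n + 1) (k + 1)"
  by (simp add: gen_stirling1_def mult.commute[of "prod _ _"])

lemma gen_stirling1_Suc_1: "gen_stirling1 f t (n + 1) 1 = gen_fact f t n"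
  by (simp add: gen_stirling1_def gen_fact_def poly_prod flip: poly_0_coeff_0)

lemma gen_fact_Suc: "gen_fact f t (n + 1) = f (n + 1) / t ^ (n + 1) * gen_fact f t n"
  by (simp add: gen_fact_def mult.commute)

lemma gen_fact_nonzero:
  assumes "\<And>k. k \<ge> 1 \<Longrightarrow> f k \<noteq> 0" and "t \<noteq> 0"
  shows "gen_fact f t n \<noteq> 0"
  using assms by (simp add: gen_fact_def)

text \<open>
  The recurrence turns the summand into a difference of consecutive values of
  \<open>(-1) ^ m * a ^ (m + 1) * [n+1, m+1]\<close>, whose value at \<open>m = 0\<close> is the factorial.
\<close>

lemma sum_alternating_gen_stirling1:
  fixes f :: "nat \<Rightarrow> complex" and t :: complex and n q :: nat
  defines "a \<equiv> f (n + 1) / t ^ (n + 1)"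
  shows "(\<Sum>m<q. (-1) ^ m * a ^ (m + 1) * gen_stirling1 f t (n + 2) (m + 2)) =
           gen_fact f t (n + 1) - (-1) ^ q * a ^ (q + 1) * gen_stirling1 f t (n + 1) (q + 1)"
proof (induction q)
  case 0
  show ?case
    using gen_stirling1_Suc_1[of f t n] gen_fact_Suc[of f t n] by (simp add: a_def)
next
  case (Suc q)
  have "gen_stirling1 f t (n + 2) (q + 2) =
          a * gen_stirling1 f t (n + 1) (q + 2) + gen_stirling1 f t (n + 1) (q + 1)"
    unfolding a_def by (rule gen_stirling1_Suc_Suc)
  with Suc.IH show ?case
    by (simp add: algebra_simps)
qed

text \<open>
  The summands of both identities carry \<open>t\<close> and \<open>f (n+1)\<close> in place of \<open>a\<close>, and negative powers of
  \<open>a\<close> in place of positive ones; this brings them to the form of the telescoping sum.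
\<close>

lemma power_div_power_eq:
  fixes x y :: "'a :: field"
  assumes "x \<noteq> 0" "y \<noteq> 0" "i + j = p"
  shows "y ^ (j * n) / x ^ j = (x / y ^ n) ^ i / (x / y ^ n) ^ p"
proof -
  have "(x / y ^ n) ^ p = (x / y ^ n) ^ i * (x / y ^ n) ^ j"
    by (simp add: assms(3)[symmetric] power_add)
  then show ?thesis
    using assms(1,2) by (simp add: power_divide power_mult[symmetric] mult.commute)
qed

theorem proposition2p4:
  fixes f :: "nat \<Rightarrow> complex" and t :: complex and n p :: nat
  assumes "\<And>k. k \<ge> 1 \<Longrightarrow> f k \<noteq> 0"
    and "t \<noteq> 0"
    and "p \<ge> 2"
  shows "gen_harm f p (n + 1) (t ^ p) =
           gen_harm f p n (t ^ p)
           + (\<Sum>j\<in>{1..<p}. gen_stirling1 f t (n + 2) (p + 1 - j)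
                * ((-1) ^ (p + 1 - j) * t ^ (j * (n + 1)))
                / (f (n + 1) ^ j * gen_fact f t (n + 1)))
           + gen_stirling1 f t (n + 1) p * (-1) ^ (p + 1) / gen_fact f t (n + 1)
       \<and> gen_harm f p (n + 1) (t ^ p) =
           gen_harm f p n (t ^ p)
           + t ^ ((p - 1) * (n + 1)) / f (n + 1) ^ (p - 1)
           + (-1) ^ (p - 1) / gen_fact f t (n + 1)
               * (gen_stirling1 f t (n + 1) p + gen_stirling1 f t (n + 1) (p - 1))
           + gen_stirling1 f t (n + 2) p
               * ((-1) ^ p * t ^ (n + 1)) / (f (n + 1) * gen_fact f t (n + 1))
           + (\<Sum>j\<in>{0..<p - 2}. gen_stirling1 f t (n + 2) (j + 2)
                * ((-1) ^ (j + 1) * (f (n + 1) * t powi (- int (n + 1)) - 1)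
                     * t ^ ((p - 1 - j) * (n + 1)))
                / (f (n + 1) ^ (p - 1 - j) * gen_fact f t (n + 1)))"
proof -
  define a where "a = f (n + 1) / t ^ (n + 1)"
  define F where "F = gen_fact f t (n + 1)"
  define S where "S = gen_stirling1 f t (n + 1)"
  define T where "T = gen_stirling1 f t (n + 2)"
  define H where "H = gen_harm f p n (t ^ p)"
  have fn: "f (n + 1) \<noteq> 0" using assms(1) by simp
  have a0: "a \<noteq> 0" using fn assms(2) by (simp add: a_def)
  have F0: "F \<noteq> 0" unfolding F_def using assms(1,2) by (rule gen_fact_nonzero)
  have power_a: "t ^ (j * (n + 1)) / f (n + 1) ^ j = a ^ i / a ^ p" if "i + j = p" for i j
    unfolding a_def by (rule power_div_power_eq[OF fn assms(2) that])
  have tele: "(\<Sum>m<q. (-1) ^ m * a ^ (m + 1) * T (m + 2)) = F - (-1) ^ q * a ^ (q + 1) * S (q + 1)"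
    for q unfolding a_def T_def F_def S_def by (rule sum_alternating_gen_stirling1)
  obtain r where p: "p = r + 2" using assms(3) by (metis le_Suc_ex add.commute)
  have harm: "gen_harm f p (n + 1) (t ^ p) = H + 1 / a ^ p"
    using power_a[of 0 p]
    by (simp add: gen_harm_def H_def power_mult[symmetric] del: power_Suc)

  \<comment> \<open>The exponent of \<open>1 / a\<close> and the lower index of \<open>T\<close> add up to \<open>p + 1\<close>, so reversing the
    order of summation by \<open>m = p - 1 - j\<close> and factoring out \<open>1 / a ^ p\<close> gives the telescoping sum.\<close>
  have sum1: "(\<Sum>j\<in>{1..<p}. T (p + 1 - j) * ((-1) ^ (p + 1 - j) * t ^ (j * (n + 1)))
                / (f (n + 1) ^ j * F))
              = (\<Sum>m<p - 1. (-1) ^ m * a ^ (m + 1) * T (m + 2)) / (a ^ p * F)"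
    unfolding sum_divide_distrib
  proof (rule sum.reindex_bij_witness[of _ "\<lambda>m. p - 1 - m" "\<lambda>j. p - 1 - j"])
    fix j assume "j \<in> {1..<p}"
    then obtain m where m: "p = m + 1 + j"
      by (metis atLeastLessThan_iff less_natE add.commute Suc_eq_plus1 add_Suc_right)
    have *: "p - 1 - j = m" "p + 1 - j = m + 2" using m by simp_all
    have "T (m + 2) * ((-1) ^ (m + 2) * t ^ (j * (n + 1))) / (f (n + 1) ^ j * F)
            = T (m + 2) * (-1) ^ m / F * (t ^ (j * (n + 1)) / f (n + 1) ^ j)"
      by (simp add: mult_ac)
    also have "\<dots> = T (m + 2) * (-1) ^ m / F * (a ^ (m + 1) / a ^ p)"
      using power_a[of "m + 1" j] m by simp
    finally show "(-1) ^ (p - 1 - j) * a ^ (p - 1 - j + 1) * T (p - 1 - j + 2) / (a ^ p * F)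
        = T (p + 1 - j) * ((-1) ^ (p + 1 - j) * t ^ (j * (n + 1))) / (f (n + 1) ^ j * F)"
      unfolding * by (simp add: mult_ac)
  qed auto
  have first: "1 / a ^ p = (\<Sum>m<p - 1. (-1) ^ m * a ^ (m + 1) * T (m + 2)) / (a ^ p * F)
                 + S p * (-1) ^ (p + 1) / F"
    unfolding tele using a0 F0 by (simp add: p field_simps)

  have a_powi: "f (n + 1) * t powi (- int (n + 1)) = a"
    unfolding a_def power_int_minus power_int_of_nat by (simp add: divide_inverse)
  have sum2: "(\<Sum>j\<in>{0..<p - 2}. T (j + 2) * ((-1) ^ (j + 1) * (a - 1) * t ^ ((p - 1 - j) * (n + 1)))
                / (f (n + 1) ^ (p - 1 - j) * F))
              = - (a - 1) * (\<Sum>m<p - 2. (-1) ^ m * a ^ (m + 1) * T (m + 2)) / (a ^ p * F)"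
    unfolding sum_distrib_left sum_divide_distrib atLeast0LessThan
  proof (rule sum.cong[OF refl])
    fix j assume "j \<in> {..<p - 2}"
    then have "(j + 1) + (p - 1 - j) = p" by auto
    note pw = power_a[OF this]
    have "T (j + 2) * ((-1) ^ (j + 1) * (a - 1) * t ^ ((p - 1 - j) * (n + 1)))
              / (f (n + 1) ^ (p - 1 - j) * F)
          = T (j + 2) * (-1) ^ (j + 1) * (a - 1) / F
              * (t ^ ((p - 1 - j) * (n + 1)) / f (n + 1) ^ (p - 1 - j))"
      by (simp add: mult_ac)
    also have "\<dots> = - (a - 1) * ((-1) ^ j * a ^ (j + 1) * T (j + 2)) / (a ^ p * F)"
      unfolding pw by (simp add: mult_ac del: minus_diff_eq)
    finally show "T (j + 2) * ((-1) ^ (j + 1) * (a - 1) * t ^ ((p - 1 - j) * (n + 1)))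
              / (f (n + 1) ^ (p - 1 - j) * F)
          = - (a - 1) * ((-1) ^ j * a ^ (j + 1) * T (j + 2)) / (a ^ p * F)" .
  qed
  have T_p: "T p = a * S p + S (p - 1)"
    using gen_stirling1_Suc_Suc[of f t n r] by (simp add: T_def S_def a_def p)
  have t_p1: "t ^ ((p - 1) * (n + 1)) / f (n + 1) ^ (p - 1) = a / a ^ p"
    using power_a[of 1 "p - 1"] p by simp
  have T_coeff: "T p * ((-1) ^ p * t ^ (n + 1)) / (f (n + 1) * F) = T p * (-1) ^ p / (a * F)"
    using fn assms(2) F0 by (simp add: a_def field_simps)
  have second: "1 / a ^ p = a / a ^ p + (-1) ^ (p - 1) / F * (S p + S (p - 1))
                  + T p * (-1) ^ p / (a * F)
                  + - (a - 1) * (\<Sum>m<p - 2. (-1) ^ m * a ^ (m + 1) * T (m + 2)) / (a ^ p * F)"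
    unfolding tele T_p using a0 F0 by (simp add: p field_simps)

  show ?thesis
    unfolding F_def[symmetric] S_def[symmetric] T_def[symmetric] H_def[symmetric]
      harm a_powi sum1 sum2 t_p1 T_coeff
    using first second by (simp add: add.assoc)
qed

end
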